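(* Let $\mathcal{V}$ be a finite set, $\theta\in\mathbb{R}^d$, let $\pi_\theta$ be a probability distribution on $\mathcal{V}$ with $\pi_\theta(j)>0$ differentiable in $\theta$ for every $j\in\mathcal{V}$, and let $\pi_{\mathrm{ref}}$ be a probability distribution on $\mathcal{V}$, independent of $\theta$, with $\pi_{\mathrm{ref}}(j)>0$ for all $j$. For $p\in\mathcal{V}$ let $w=\pi_{\mathrm{ref}}(p)/\pi_\theta(p)$ and $r=\pi_\theta(p)/\mathrm{sg}(\pi_\theta(p))$, and define $$\mathrm{K3}^{++}=r\,(-\log w+w-1),\qquad \mathrm{K4}=r\cdot\mathrm{sg}(-\log w).$$ Then each estimator $\widehat{\mathrm{KL}}\in\{\mathrm{K3}^{++},\mathrm{K4}\}$ gives both unbiased values and unbiased gradients of the reverse KL divergence $\mathrm{KL}(\pi_\theta\|\pi_{\mathrm{ref}})=\sum_{j\in\mathcal{V}}\pi_\theta(j)\log\frac{\pi_\theta(j)}{\pi_{\mathrm{ref}}(j)}$: $$\mathbb{E}_{p\sim\pi_\theta}\big[\widehat{\mathrm{KL}}\big]=\mathrm{KL}(\pi_\theta\|\pi_{\mathrm{ref}}),\qquad \mathbb{E}_{p\sim\pi_\theta}\big[\nabla_\theta\widehat{\mathrm{KL}}\big]=\nabla_\theta\mathrm{KL}(\pi_\theta\|\pi_{\mathrm{ref}}).$$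
   Context: $\mathrm{sg}(\cdot)$ is the stop-gradient operator: it acts as the identity when an expression is evaluated, but its argument is treated as a constant when the expression is differentiated. Formally, an expression with stop-gradients is a function $E(\theta;\bar\theta)$ where every occurrence of $\theta$ inside an $\mathrm{sg}(\cdot)$ is replaced by $\bar\theta$; its value is $E(\theta;\theta)$ and its gradient is $\nabla_\theta E(\theta;\bar\theta)|_{\bar\theta=\theta}$. In $\mathbb{E}_{p\sim\pi_\theta}[\nabla_\theta(\cdot)]$ the gradient is taken with the sampled element $p$ held fixed, and then averaged over $p$ with weights $\pi_\theta(p)$ (the sampling distribution is not differentiated). In the application $\mathcal{V}$ is a vocabulary and $\pi_\theta,\pi_{\mathrm{ref}}$ are next-token distributions given a fixed prefix. *)

theory Defs
  imports "HOL-Probability.Probability_Mass_Function"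
begin

definition gradient :: "('a::real_inner \<Rightarrow> real) \<Rightarrow> 'a \<Rightarrow> 'a" where
  "gradient f x = (THE D. GDERIV f x :> D)"

text \<open>
  An expression with stop-gradients is a function of two arguments: the live parameter and the
  frozen copy that replaces it inside every stop-gradient. A gradient is taken in the live
  argument only, and the frozen argument is then set to the same parameter.
\<close>

type_synonym 'a sg_expr = "'a \<Rightarrow> 'a \<Rightarrow> real"

definition sg :: "'a sg_expr \<Rightarrow> 'a sg_expr" where
  "sg E = (\<lambda>\<theta> \<theta>'. E \<theta>' \<theta>')"

definition sg_value :: "'a sg_expr \<Rightarrow> 'a \<Rightarrow> real" where
  "sg_value E \<theta> = E \<theta> \<theta>"

definition sg_differentiable :: "'a::real_inner sg_expr \<Rightarrow> 'a \<Rightarrow> bool" where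
  "sg_differentiable E \<theta> \<longleftrightarrow> (\<lambda>t. E t \<theta>) differentiable (at \<theta>)"

definition sg_gradient :: "'a::real_inner sg_expr \<Rightarrow> 'a \<Rightarrow> 'a" where
  "sg_gradient E \<theta> = gradient (\<lambda>t. E t \<theta>) \<theta>"

definition KL :: "'v::finite pmf \<Rightarrow> 'v pmf \<Rightarrow> real" where
  "KL P Q = (\<Sum>j\<in>UNIV. pmf P j * ln (pmf P j / pmf Q j))"

definition prob_expr :: "('a \<Rightarrow> 'v pmf) \<Rightarrow> 'v \<Rightarrow> 'a sg_expr" where
  "prob_expr \<pi> p = (\<lambda>\<theta> \<theta>'. pmf (\<pi> \<theta>) p)"

definition w_expr :: "('a \<Rightarrow> 'v pmf) \<Rightarrow> 'v pmf \<Rightarrow> 'v \<Rightarrow> 'a sg_expr" where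
  "w_expr \<pi> \<pi>ref p = (\<lambda>\<theta> \<theta>'. pmf \<pi>ref p / prob_expr \<pi> p \<theta> \<theta>')"

definition r_expr :: "('a \<Rightarrow> 'v pmf) \<Rightarrow> 'v \<Rightarrow> 'a sg_expr" where
  "r_expr \<pi> p = (\<lambda>\<theta> \<theta>'. prob_expr \<pi> p \<theta> \<theta>' / sg (prob_expr \<pi> p) \<theta> \<theta>')"

definition K3pp :: "('a \<Rightarrow> 'v pmf) \<Rightarrow> 'v pmf \<Rightarrow> 'v \<Rightarrow> 'a sg_expr" where
  "K3pp \<pi> \<pi>ref p = (\<lambda>\<theta> \<theta>'. r_expr \<pi> p \<theta> \<theta>' *
     (- ln (w_expr \<pi> \<pi>ref p \<theta> \<theta>') + w_expr \<pi> \<pi>ref p \<theta> \<theta>' - 1))"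

definition K4 :: "('a \<Rightarrow> 'v pmf) \<Rightarrow> 'v pmf \<Rightarrow> 'v \<Rightarrow> 'a sg_expr" where
  "K4 \<pi> \<pi>ref p = (\<lambda>\<theta> \<theta>'. r_expr \<pi> p \<theta> \<theta>' *
     sg (\<lambda>t t'. - ln (w_expr \<pi> \<pi>ref p t t')) \<theta> \<theta>')"

end

(* Both estimators have the per-sample gradient (ln (\<pi> p / \<pi>ref p) / \<pi> p) * grad \<pi> p: in K3++ the gradient
   of w contributes nothing, because r * w = \<pi>ref p / sg(\<pi> p) is constant in the live argument, while
   differentiating r * (- ln w) and r * (-1) produces score terms +1 and -1 that cancel. Averaging over p
   gives the sum of ln (\<pi> p / \<pi>ref p) * grad \<pi> p. The gradient of KL has the additional summands grad \<pi> p,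
   whose total vanishes since probabilities sum to one. *)
theory Submission
  imports Defs
begin

lemma GDERIV_unique:
  assumes "GDERIV f x :> D" "GDERIV f x :> D'"
  shows "D = D'"
proof -
  have "(\<lambda>h. inner h D) = (\<lambda>h. inner h D')"
    using assms unfolding gderiv_def by (rule has_derivative_unique)
  then have "\<forall>h. inner h D = inner h D'"
    by (simp add: fun_eq_iff)
  then show ?thesis
    by (simp only: vector_eq_ldot)
qed

text \<open>Uniqueness of the derivative resolves the definite description in
  \<open>gradient\<close>.\<close>

lemma gradient_eq: "GDERIV f x :> D \<Longrightarrow> gradient f x = D"
  unfolding gradient_def by (blast intro: GDERIV_unique)

lemma GDERIV_imp_differentiable: "GDERIV f x :> D \<Longrightarrow> f differentiable (at x)"
  unfolding gderiv_def differentiable_def by blast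

text \<open>Riesz representation: the functional \<open>F\<close> is the inner product with
  \<open>adjoint F 1\<close>, since \<open>F h\<close> is the inner product of \<open>F h\<close>
  and 1 in the reals.\<close>

lemma differentiable_imp_GDERIV:
  fixes f :: "'a::euclidean_space \<Rightarrow> real"
  assumes "f differentiable (at x)"
  shows "\<exists>D. GDERIV f x :> D"
proof -
  obtain F where F: "(f has_derivative F) (at x)"
    using assms unfolding differentiable_def by blast
  have "F = (\<lambda>h. inner h (adjoint F 1))"
    using adjoint_works[OF has_derivative_linear[OF F], of _ 1] by auto
  with F show ?thesis
    unfolding gderiv_def by metis
qed

lemma GDERIV_sum:
  assumes "\<And>i. i \<in> I \<Longrightarrow> GDERIV (f i) x :> D i"
  shows "GDERIV (\<lambda>t. \<Sum>i\<in>I. f i t) x :> (\<Sum>i\<in>I. D i)"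
  using assms unfolding gderiv_def inner_sum_right by (rule has_derivative_sum)

lemma sum_pmf_UNIV: "(\<Sum>j\<in>UNIV. pmf P j) = 1" for P :: "'v::finite pmf"
  by (rule sum_pmf_eq_1) auto

text \<open>The total mass is constantly 1 in the parameter, so its gradient is zero; equivalently,
  the score has mean zero.\<close>

lemma sum_GDERIV_pmf_eq_0:
  fixes \<pi> :: "'a::real_inner \<Rightarrow> 'v::finite pmf"
  assumes "\<And>j. GDERIV (\<lambda>t. pmf (\<pi> t) j) \<theta> :> D j"
  shows "(\<Sum>j\<in>UNIV. D j) = 0"
proof -
  have "GDERIV (\<lambda>t. \<Sum>j\<in>UNIV. pmf (\<pi> t) j) \<theta> :> (\<Sum>j\<in>UNIV. D j)"
    by (rule GDERIV_sum) (rule assms)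
  then show ?thesis
    unfolding sum_pmf_UNIV using GDERIV_const GDERIV_unique by blast
qed

lemma expectation_pmf_finite:
  fixes f :: "'v::finite \<Rightarrow> 'b::{banach, second_countable_topology}"
  shows "measure_pmf.expectation P f = (\<Sum>j\<in>UNIV. pmf P j *\<^sub>R f j)"
  by (rule integral_measure_pmf) auto

lemma GDERIV_KL:
  fixes \<pi> :: "'a::real_inner \<Rightarrow> 'v::finite pmf"
  assumes D: "\<And>j. GDERIV (\<lambda>t. pmf (\<pi> t) j) \<theta> :> D j"
    and P: "\<And>j. pmf (\<pi> \<theta>) j > 0" and Q: "\<And>j. pmf Q j > 0"
  shows "GDERIV (\<lambda>t. KL (\<pi> t) Q) \<theta> :> (\<Sum>j\<in>UNIV. ln (pmf (\<pi> \<theta>) j / pmf Q j) *\<^sub>R D j)"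
proof -
  have "GDERIV (\<lambda>t. pmf (\<pi> t) j * ln (pmf (\<pi> t) j / pmf Q j)) \<theta>
      :> (ln (pmf (\<pi> \<theta>) j / pmf Q j) + 1) *\<^sub>R D j" for j
  proof -
    \<comment> \<open>Each summand depends on the parameter only through the probability
      \<open>q\<close>, so the chain rule reduces its gradient to a one-variable derivative.\<close>
    have "((\<lambda>q. q * ln (q / pmf Q j)) has_real_derivative (ln (pmf (\<pi> \<theta>) j / pmf Q j) + 1))
        (at (pmf (\<pi> \<theta>) j))"
      by (rule derivative_eq_intros refl | use P[of j] Q[of j] in \<open>simp; fail\<close>)+
    from GDERIV_DERIV_compose[OF D this] show ?thesis .
  qed
  then have "GDERIV (\<lambda>t. KL (\<pi> t) Q) \<theta>
      :> (\<Sum>j\<in>UNIV. (ln (pmf (\<pi> \<theta>) j / pmf Q j) + 1) *\<^sub>R D j)"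
    unfolding KL_def by (rule GDERIV_sum)
  then show ?thesis
    by (simp add: scaleR_add_left sum.distrib sum_GDERIV_pmf_eq_0[OF D])
qed

lemma GDERIV_K3pp:
  assumes D: "GDERIV (\<lambda>t. pmf (\<pi> t) p) \<theta> :> D"
    and P: "pmf (\<pi> \<theta>) p > 0" and Q: "pmf Q p > 0"
  shows "GDERIV (\<lambda>t. K3pp \<pi> Q p t \<theta>) \<theta>
    :> (ln (pmf (\<pi> \<theta>) p / pmf Q p) / pmf (\<pi> \<theta>) p) *\<^sub>R D"
proof -
  let ?a = "pmf (\<pi> \<theta>) p" and ?b = "pmf Q p"
  have "((\<lambda>q. q / ?a * (- ln (?b / q) + ?b / q - 1)) has_real_derivative ln (?a / ?b) / ?a) (at ?a)"
    apply (rule derivative_eq_intros refl | use P Q in \<open>simp; fail\<close>)+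
    using P Q apply (simp add: ln_div)
    apply (simp add: field_simps)
    done
  from GDERIV_DERIV_compose[OF D this] show ?thesis
    by (simp add: K3pp_def r_expr_def w_expr_def prob_expr_def sg_def)
qed

lemma GDERIV_K4:
  assumes D: "GDERIV (\<lambda>t. pmf (\<pi> t) p) \<theta> :> D"
    and P: "pmf (\<pi> \<theta>) p > 0" and Q: "pmf Q p > 0"
  shows "GDERIV (\<lambda>t. K4 \<pi> Q p t \<theta>) \<theta>
    :> (ln (pmf (\<pi> \<theta>) p / pmf Q p) / pmf (\<pi> \<theta>) p) *\<^sub>R D"
proof -
  let ?a = "pmf (\<pi> \<theta>) p" and ?b = "pmf Q p"
  \<comment> \<open>The logarithm is frozen too, so the function is linear in
    \<open>q\<close>.\<close>
  have "((\<lambda>q. q / ?a * (- ln (?b / ?a))) has_real_derivative ln (?a / ?b) / ?a) (at ?a)"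
    apply (rule derivative_eq_intros refl | use P Q in \<open>simp; fail\<close>)+
    using P Q by (simp add: ln_div)
  from GDERIV_DERIV_compose[OF D this] show ?thesis
    by (simp add: K4_def r_expr_def w_expr_def prob_expr_def sg_def)
qed

text \<open>In value \<open>r\<close> is 1, and the mean of \<open>w - 1\<close> is the total mass
  of \<open>Q\<close> minus that of \<open>\<pi> \<theta>\<close>, hence 0; what remains is the mean
  of \<open>- ln w\<close>.\<close>

lemma expectation_K3pp:
  fixes \<pi> :: "'a \<Rightarrow> 'v::finite pmf"
  assumes P: "\<And>j. pmf (\<pi> \<theta>) j > 0" and Q: "\<And>j. pmf Q j > 0"
  shows "measure_pmf.expectation (\<pi> \<theta>) (\<lambda>p. sg_value (K3pp \<pi> Q p) \<theta>) = KL (\<pi> \<theta>) Q"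
proof -
  have "pmf (\<pi> \<theta>) p * sg_value (K3pp \<pi> Q p) \<theta>
      = pmf (\<pi> \<theta>) p * ln (pmf (\<pi> \<theta>) p / pmf Q p) + pmf Q p - pmf (\<pi> \<theta>) p" for p
    using P[of p] Q[of p]
    by (simp add: sg_value_def K3pp_def r_expr_def w_expr_def prob_expr_def sg_def ln_div field_simps)
  then show ?thesis
    by (simp add: expectation_pmf_finite KL_def sum.distrib sum_subtractf sum_pmf_UNIV)
qed

lemma expectation_K4:
  fixes \<pi> :: "'a \<Rightarrow> 'v::finite pmf"
  assumes P: "\<And>j. pmf (\<pi> \<theta>) j > 0" and Q: "\<And>j. pmf Q j > 0"
  shows "measure_pmf.expectation (\<pi> \<theta>) (\<lambda>p. sg_value (K4 \<pi> Q p) \<theta>) = KL (\<pi> \<theta>) Q"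
proof -
  have "sg_value (K4 \<pi> Q p) \<theta> = ln (pmf (\<pi> \<theta>) p / pmf Q p)" for p
    using P[of p] Q[of p]
    by (simp add: sg_value_def K4_def r_expr_def w_expr_def prob_expr_def sg_def ln_div)
  then show ?thesis
    by (simp add: expectation_pmf_finite KL_def)
qed

theorem mainTheorem2:
  fixes \<pi> :: "real ^ 'd \<Rightarrow> 'v::finite pmf"
    and \<pi>ref :: "'v pmf"
    and \<theta> :: "real ^ 'd"
    and Est :: "'v \<Rightarrow> (real ^ 'd) sg_expr"
  assumes pi_pos: "\<And>j. pmf (\<pi> \<theta>) j > 0"
    and pi_diff: "\<And>j. (\<lambda>t. pmf (\<pi> t) j) differentiable (at \<theta>)"
    and ref_pos: "\<And>j. pmf \<pi>ref j > 0"
    and Est: "Est \<in> {K3pp \<pi> \<pi>ref, K4 \<pi> \<pi>ref}"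
  shows "measure_pmf.expectation (\<pi> \<theta>) (\<lambda>p. sg_value (Est p) \<theta>) = KL (\<pi> \<theta>) \<pi>ref
    \<and> (\<lambda>t. KL (\<pi> t) \<pi>ref) differentiable (at \<theta>)
    \<and> (\<forall>p. sg_differentiable (Est p) \<theta>)
    \<and> measure_pmf.expectation (\<pi> \<theta>) (\<lambda>p. sg_gradient (Est p) \<theta>)
        = gradient (\<lambda>t. KL (\<pi> t) \<pi>ref) \<theta>"
proof -
  obtain D where D: "\<And>j. GDERIV (\<lambda>t. pmf (\<pi> t) j) \<theta> :> D j"
    using differentiable_imp_GDERIV[OF pi_diff] by metis
  have grad: "GDERIV (\<lambda>t. Est p t \<theta>) \<theta>
      :> (ln (pmf (\<pi> \<theta>) p / pmf \<pi>ref p) / pmf (\<pi> \<theta>) p) *\<^sub>R D p" for p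
    using Est GDERIV_K3pp[OF D pi_pos ref_pos, of p] GDERIV_K4[OF D pi_pos ref_pos, of p] by auto
  have kl: "GDERIV (\<lambda>t. KL (\<pi> t) \<pi>ref) \<theta>
      :> (\<Sum>j\<in>UNIV. ln (pmf (\<pi> \<theta>) j / pmf \<pi>ref j) *\<^sub>R D j)"
    by (rule GDERIV_KL[OF D pi_pos ref_pos])
  have "measure_pmf.expectation (\<pi> \<theta>) (\<lambda>p. sg_value (Est p) \<theta>) = KL (\<pi> \<theta>) \<pi>ref"
    using Est expectation_K3pp[of \<pi> \<theta> \<pi>ref] expectation_K4[of \<pi> \<theta> \<pi>ref] pi_pos ref_pos by auto
  moreover have "sg_differentiable (Est p) \<theta>" for p
    unfolding sg_differentiable_def by (rule GDERIV_imp_differentiable[OF grad])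
  moreover have "measure_pmf.expectation (\<pi> \<theta>) (\<lambda>p. sg_gradient (Est p) \<theta>)
      = gradient (\<lambda>t. KL (\<pi> t) \<pi>ref) \<theta>"
    \<comment> \<open>Positivity lets the sampling weight cancel the denominator of the per-sample
      gradient.\<close>
    using pi_pos
    by (simp add: sg_gradient_def gradient_eq[OF grad] gradient_eq[OF kl] expectation_pmf_finite
        less_imp_neq[THEN not_sym])
  ultimately show ?thesis
    using GDERIV_imp_differentiable[OF kl] by blast
qed

end
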